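(* For integers $i,j,k\ge 0$ let $\mu_{i,j}^{k}=-\mu_{j,i}^{k}$ and $\beta_i^{k}$ be real numbers. Set $Pf(i,j)^{k}=\mu_{i,j}^{k}$, $Pf(d_0,i)^{k}=\beta_i^{k}$, $Pf(d_1,i)^{k}=\beta_{i+1}^{k}$, $Pf(d_0,d_1)^{k}=0$, and assume $$\mu_{i,j}^{k+1}=\mu_{i,j}^{k}+Pf(d_0,d_1,i,j)^{k}=\mu_{i,j}^{k}+\mu_{i+1,j}^{k}+\mu_{i,j+1}^{k}+\mu_{i+1,j+1}^{k},\qquad \beta_i^{k+1}=\beta_{i+1}^{k}+\beta_i^{k}.$$ Define $$\tau_{2n}^{k}=Pf(0,1,\dots,2n-1)^{k},\qquad \tau_{2n+1}^{k}=Pf(d_0,0,1,\dots,2n)^{k},$$ and assume $\tau_n^{k}\neq 0$ for all $n,k\ge0$. Then $$v_n^{k}=\frac{\tau_{n+1}^{k}}{\tau_n^{k}},\qquad u_n^{k}=\frac{\tau_n^{k+1}}{\tau_n^{k}}$$ satisfy, for all $n,k\ge 0$, the full-discrete 2D B-Toda lattice $$v_n^{k+1}u_n^{k}=v_n^{k}u_{n+1}^{k},\qquad \frac{u_{n+1}^{k+1}}{u_{n+1}^{k}}=1+\frac{v_{n+1}^{k}u_n^{k+1}}{u_{n+1}^{k}v_n^{k+1}}-\frac{v_{n+1}^{k+1}}{v_n^{k+1}}.$$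
   Context: Hirota's Pfaffian notation: given symbols $a_1,\dots,a_{2N}$ and prescribed entries $Pf(a_i,a_j)=-Pf(a_j,a_i)$, $Pf(a_1,\dots,a_{2N})$ denotes the Pfaffian of the $2N\times 2N$ skew-symmetric matrix with $(i,j)$ entry $Pf(a_i,a_j)$; the empty Pfaffian is $1$ (so $\tau_0^{k}=1$). A superscript $k$ on $Pf$ means the entries with that superscript are used. In particular $Pf(d_0,d_1,i,j)^{k}=\beta_{i+1}^{k}\beta_j^{k}-\beta_i^{k}\beta_{j+1}^{k}$. *)

theory Defs
  imports Complex_Main "HOL-Combinatorics.Permutations"
begin

text \<open>
  The Pfaffian of the \<open>2N \<times> 2N\<close> skew-symmetric matrix \<open>A\<close>, with rows and columns numbered
  from \<open>0\<close>, by the permutation formula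
  \<open>1 / (2^N N!) * \<Sum>\<^sub>p sgn(p) * A\<^bsub>p(0),p(1)\<^esub> * A\<^bsub>p(2),p(3)\<^esub> * \<dots> * A\<^bsub>p(2N-2),p(2N-1)\<^esub>\<close>.
\<close>

definition pfaffian :: "nat \<Rightarrow> (nat \<Rightarrow> nat \<Rightarrow> real) \<Rightarrow> real" where
  "pfaffian N A =
     (\<Sum>p | p permutes {..<2 * N}. of_int (sign p) * (\<Prod>i<N. A (p (2 * i)) (p (2 * i + 1))))
       / (2 ^ N * fact N)"

text \<open>The symbols \<open>d\<^sub>0\<close>, \<open>d\<^sub>1\<close> and \<open>0, 1, 2, \<dots>\<close> of Hirota's notation.\<close>

datatype symb = D0 | D1 | Idx nat

text \<open>
  The prescribed entries at one fixed superscript \<open>k\<close>, extended by \<open>Pf(b, a) = - Pf(a, b)\<close>;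
  the arguments are \<open>\<mu>\<^sup>k\<close> and \<open>\<beta>\<^sup>k\<close>.  The values form a skew-symmetric matrix as soon as
  \<open>\<mu>\<^sup>k\<close> is skew-symmetric.
\<close>

fun Pf_entry :: "(nat \<Rightarrow> nat \<Rightarrow> real) \<Rightarrow> (nat \<Rightarrow> real) \<Rightarrow> symb \<Rightarrow> symb \<Rightarrow> real" where
  "Pf_entry \<mu> \<beta> (Idx i) (Idx j) = \<mu> i j"
| "Pf_entry \<mu> \<beta> D0 (Idx i) = \<beta> i"
| "Pf_entry \<mu> \<beta> (Idx i) D0 = - \<beta> i"
| "Pf_entry \<mu> \<beta> D1 (Idx i) = \<beta> (Suc i)"
| "Pf_entry \<mu> \<beta> (Idx i) D1 = - \<beta> (Suc i)"
| "Pf_entry \<mu> \<beta> D0 D1 = 0"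
| "Pf_entry \<mu> \<beta> D1 D0 = 0"
| "Pf_entry \<mu> \<beta> D0 D0 = 0"
| "Pf_entry \<mu> \<beta> D1 D1 = 0"

text \<open>
  Hirota's \<open>Pf(a\<^sub>1, \<dots>, a\<^bsub>2N\<^esub>)\<close> for the list of symbols \<open>[a\<^sub>1, \<dots>, a\<^bsub>2N\<^esub>]\<close>; meaningful only for
  lists of even length.
\<close>

definition Pf :: "(nat \<Rightarrow> nat \<Rightarrow> real) \<Rightarrow> (nat \<Rightarrow> real) \<Rightarrow> symb list \<Rightarrow> real" where
  "Pf \<mu> \<beta> as = pfaffian (length as div 2) (\<lambda>i j. Pf_entry \<mu> \<beta> (as ! i) (as ! j))"

lemma Pf_Nil: "Pf \<mu> \<beta> [] = 1"
  by (simp add: Pf_def pfaffian_def sign_id)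

lemma Pf_entry_skew:
  assumes "\<And>i j. \<mu> i j = - \<mu> j i"
  shows "Pf_entry \<mu> \<beta> b a = - Pf_entry \<mu> \<beta> a b"
  by (cases a; cases b; simp; rule assms)

lemma sum_signed_permutations_insert:
  fixes F :: "(nat \<Rightarrow> nat) \<Rightarrow> real"
  assumes "finite S" "a \<notin> S"
  shows "(\<Sum>p | p permutes insert a S. of_int (sign p) * F p) =
    (\<Sum>b\<in>insert a S. (if a = b then 1 else - 1) *
       (\<Sum>q | q permutes S. of_int (sign q) * F (transpose a b \<circ> q)))"
proof -
  have "(\<Sum>p | p permutes insert a S. of_int (sign p) * F p) =
    (\<Sum>b\<in>insert a S. \<Sum>q | q permutes S.
       of_int (sign (transpose a b \<circ> q)) * F (transpose a b \<circ> q))"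
    by (rule sum_over_permutations_insert[OF assms])
  also have "\<dots> = (\<Sum>b\<in>insert a S. (if a = b then 1 else - 1) *
       (\<Sum>q | q permutes S. of_int (sign q) * F (transpose a b \<circ> q)))"
  proof (rule sum.cong[OF refl])
    fix b
    have "sign (transpose a b \<circ> q) = (if a = b then 1 else - 1) * sign q" if "q permutes S" for q
      using that assms(1)
      by (subst sign_compose) (auto simp: permutation_swap_id sign_swap_id intro: permutes_imp_permutation)
    then show "(\<Sum>q | q permutes S. of_int (sign (transpose a b \<circ> q)) * F (transpose a b \<circ> q))
      = (if a = b then 1 else - 1) *
       (\<Sum>q | q permutes S. of_int (sign q) * F (transpose a b \<circ> q))"
      unfolding sum_distrib_left by (intro sum.cong) auto
  qed
  finally show ?thesis .
qed

lemma pfaffian_2: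
  assumes skew: "\<And>i j. A i j = - A j i"
  shows "pfaffian 2 A = A 0 1 * A 2 3 - A 0 2 * A 1 3 + A 0 3 * A 1 2"
proof -
  have S: "{..<2 * 2} = {0, 1, 2, 3 :: nat}" and T: "{..<2} = {0, 1 :: nat}"
    by auto
  have *: "A 1 0 = - A 0 1" "A 2 0 = - A 0 2" "A 3 0 = - A 0 3"
    "A 2 1 = - A 1 2" "A 3 1 = - A 1 3" "A 3 2 = - A 2 3"
    by (rule skew)+
  have P2: "(\<Sum>p | p permutes {2, 3}. of_int (sign p) * F p) = F id - F (transpose 2 3)"
    for F :: "(nat \<Rightarrow> nat) \<Rightarrow> real"
    by (subst sum_signed_permutations_insert) (simp_all add: sign_id)
  have P3: "(\<Sum>p | p permutes {1, 2, 3}. of_int (sign p) * F p) =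
      (\<Sum>b\<in>{1, 2, 3}. (if 1 = b then 1 else - 1) *
        (F (transpose 1 b) - F (transpose 1 b \<circ> transpose 2 3)))"
    for F :: "(nat \<Rightarrow> nat) \<Rightarrow> real"
    by (subst sum_signed_permutations_insert) (simp_all only: P2 comp_id, simp_all)
  have P4: "(\<Sum>p | p permutes {0, 1, 2, 3}. of_int (sign p) * F p) =
      (\<Sum>b\<in>{0, 1, 2, 3}. (if 0 = b then 1 else - 1) *
        (\<Sum>c\<in>{1, 2, 3}. (if 1 = c then 1 else - 1) *
          (F (transpose 0 b \<circ> transpose 1 c) - F (transpose 0 b \<circ> (transpose 1 c \<circ> transpose 2 3)))))"
    for F :: "(nat \<Rightarrow> nat) \<Rightarrow> real"
    by (subst sum_signed_permutations_insert) (simp_all only: P3, simp_all)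
  show ?thesis
    unfolding pfaffian_def S T P4
    by (simp add: * transpose_def fact_numeral flip: One_nat_def)
qed

lemma Pf_D0_D1:
  assumes "\<And>i j. \<mu> i j = - \<mu> j i"
  shows "Pf \<mu> \<beta> [D0, D1, Idx i, Idx j] = \<beta> (i + 1) * \<beta> j - \<beta> i * \<beta> (j + 1)"
proof -
  let ?as = "[D0, D1, Idx i, Idx j]"
  have "length ?as div 2 = 2"
    by simp
  then have "Pf \<mu> \<beta> ?as = pfaffian 2 (\<lambda>r s. Pf_entry \<mu> \<beta> (?as ! r) (?as ! s))"
    by (simp only: Pf_def)
  also have "\<dots> = \<beta> (i + 1) * \<beta> j - \<beta> i * \<beta> (j + 1)"
    by (subst pfaffian_2, rule Pf_entry_skew, rule assms) (simp add: numeral_3_eq_3 numeral_2_eq_2)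
  finally show ?thesis .
qed

end

(* Passing from k to k + 1 changes the entries in two ways at once: by the rank two term d0 ^ d1,
   which equals d0 ^ d0' for d0' the vector of the new beta, and by replacing every index i by the
   sum of i and i + 1.  A rank two update adds Pf(d0, d0', L) to Pf(L), and replacing the indices
   0, ..., m - 1 by the sums equals inserting a symbol c with Pf(c, i) = (-1)^i in front of
   0, ..., m.  With the entries at k + 1, all tau functions at k, k + 1 and k + 2 thus become
   Pfaffians over one index set extended by some of d0, d0', c and one further index z, and
     tau_{n+1}^{k+2} tau_{n+1}^k - (tau_{n+1}^{k+1})^2
       = tau_{n+2}^k tau_n^{k+2} - tau_{n+2}^{k+1} tau_n^{k+1}
   is the Pfaffian Pluecker relation for d0, d0', c, z.  Dividing by (tau_{n+1}^{k+1})^2 gives the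
   second lattice equation; the first one is immediate. *)

theory Submission
  imports Defs
begin

subsection \<open>Expansion of the Pfaffian along the first row\<close>

text \<open>Conjugation by \<open>h\<close> is a bijection between the permutations of the two sets
  and preserves signs. It serves to renumber the positions that remain after the first pair is
  removed.\<close>

lemma sum_signed_permutations_image:
  fixes F :: "(nat \<Rightarrow> nat) \<Rightarrow> real"
  assumes "inj_on h S" "finite S"
  shows "(\<Sum>q | q permutes h ` S. of_int (sign q) * F q) =
    (\<Sum>q | q permutes S. of_int (sign q) * F (map_permutation S h q))"
proof -
  have h: "bij_betw h S (h ` S)"
    using assms(1) by (simp add: bij_betw_def)
  have h': "bij_betw (inv_into S h) (h ` S) S"
    using h by (rule bij_betw_inv_into)
  show ?thesis
  proof (rule sum.reindex_bij_witness[where i = "map_permutation S h"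
        and j = "map_permutation (h ` S) (inv_into S h)"])
    fix q assume "q \<in> {q. q permutes h ` S}"
    then have q: "q permutes h ` S" by simp
    show "map_permutation S h (map_permutation (h ` S) (inv_into S h) q) = q"
      by (rule map_permutation_compose_inv[OF h' q]) (auto intro: f_inv_into_f)
    then show "of_int (sign (map_permutation (h ` S) (inv_into S h) q)) *
        F (map_permutation S h (map_permutation (h ` S) (inv_into S h) q)) = of_int (sign q) * F q"
      using sign_map_permutation[OF _ q, of "inv_into S h"] h' assms(2)
      by (simp add: bij_betw_def)
    show "map_permutation (h ` S) (inv_into S h) q \<in> {q. q permutes S}"
      using map_permutation_permutes[OF h' q] by simp
  next
    fix q assume "q \<in> {q. q permutes S}"
    then have q: "q permutes S" by simp
    show "map_permutation (h ` S) (inv_into S h) (map_permutation S h q) = q"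
      by (rule map_permutation_compose_inv[OF h q]) (simp add: assms(1))
    show "map_permutation S h q \<in> {q. q permutes h ` S}"
      using map_permutation_permutes[OF h q] by simp
  qed
qed

lemma pfaffian_cong:
  assumes "\<And>i j. i < 2 * N \<Longrightarrow> j < 2 * N \<Longrightarrow> A i j = B i j"
  shows "pfaffian N A = pfaffian N B"
proof -
  have "A (p (2 * i)) (p (2 * i + 1)) = B (p (2 * i)) (p (2 * i + 1))"
    if "p permutes {..<2 * N}" "i < N" for p i
    using permutes_in_image[OF that(1), of "2 * i"] permutes_in_image[OF that(1), of "2 * i + 1"] that(2)
    by (intro assms) auto
  then show ?thesis
    unfolding pfaffian_def by (intro arg_cong2[where f = "(/)"] sum.cong prod.cong refl) auto
qed

text \<open>Substituting \<open>q \<circ> p\<close> for \<open>p\<close> in the defining sum absorbs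
  \<open>q\<close> into the summation variable; only its sign is left over.\<close>

lemma pfaffian_permute:
  assumes q: "q permutes {..<2 * N}"
  shows "pfaffian N (\<lambda>i j. A (q i) (q j)) = of_int (sign q) * pfaffian N A"
proof -
  let ?P = "{p. p permutes {..<2 * N}}"
  have sgn: "sign (q \<circ> p) = sign q * sign p" if "p \<in> ?P" for p
    using q that by (intro sign_compose) (auto intro: permutes_imp_permutation)
  have "(\<Sum>p\<in>?P. of_int (sign p) * (\<Prod>i<N. A (p (2 * i)) (p (2 * i + 1)))) =
    (\<Sum>p\<in>?P. of_int (sign (q \<circ> p)) * (\<Prod>i<N. A ((q \<circ> p) (2 * i)) ((q \<circ> p) (2 * i + 1))))"
    by (rule setum_permutations_compose_left[OF q])
  also have "\<dots> = of_int (sign q) *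
     (\<Sum>p\<in>?P. of_int (sign p) * (\<Prod>i<N. A (q (p (2 * i))) (q (p (2 * i + 1)))))"
    unfolding sum_distrib_left by (intro sum.cong refl) (simp add: sgn mult.assoc)
  finally have "(\<Sum>p\<in>?P. of_int (sign p) * (\<Prod>i<N. A (q (p (2 * i))) (q (p (2 * i + 1))))) =
    of_int (sign q) * (\<Sum>p\<in>?P. of_int (sign p) * (\<Prod>i<N. A (p (2 * i)) (p (2 * i + 1))))"
    by (simp add: sign_def)
  then show ?thesis
    unfolding pfaffian_def by simp
qed

text \<open>All \<open>2 * N + 2\<close> positions at which a permutation can take the value 0
  contribute equally, so position 0 may be assumed; the value at position 1 is then the summation
  index \<open>b\<close>. The remaining indices are numbered with 1 in the place of
  \<open>b\<close>, so the sign is -1 for every \<open>b\<close> other than 1 and does not yet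
  alternate.\<close>

lemma pfaffian_expand:
  assumes skew: "\<And>i j. A i j = - A j i"
  shows "pfaffian (Suc N) A = (\<Sum>b\<in>{1..<2 * N + 2}. (if b = 1 then 1 else - 1) * A 0 b *
    pfaffian N (\<lambda>r s. A (transpose 1 b (r + 2)) (transpose 1 b (s + 2))))"
proof -
  define M where "M = 2 * Suc N"
  define G where "G p = of_int (sign p) * (\<Prod>i<Suc N. A (p (2 * i)) (p (2 * i + 1)))" for p
  \<comment> \<open>Swapping two pairs of positions, or the two positions of a pair, shows that \<open>H x\<close> does not depend on \<open>x\<close>.\<close>
  define H where "H x = (\<Sum>p | p permutes {..<M}. if p x = 0 then G p else 0)" for x
  have H_eq: "H x = H (s x)" if s: "s permutes {..<M}" and
    G: "\<And>p. p permutes {..<M} \<Longrightarrow> G (p \<circ> s) = G p" and inv: "s (s x) = x" for s x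
  proof -
    have "H (s x) = (\<Sum>p | p permutes {..<M}. if (p \<circ> s) (s x) = 0 then G (p \<circ> s) else 0)"
      unfolding H_def by (rule sum_permutations_compose_right[OF s])
    also have "\<dots> = H x"
      unfolding H_def by (rule sum.cong) (auto simp: G inv)
    finally show ?thesis ..
  qed
  have sgn: "sign (p \<circ> transpose a b) = (if a = b then 1 else - 1) * sign p"
    if "p permutes {..<M}" for p a b
    using that by (subst sign_compose)
      (auto simp: permutation_swap_id sign_swap_id intro: permutes_imp_permutation)
  have tr: "transpose a b permutes {..<M}" if "a < M" "b < M" for a b
    using that by (intro permutes_swap_id) auto
  \<comment> \<open>The transposition changes the sign of \<open>p\<close> and, by skew-symmetry,
    the sign of the \<open>i\<close>-th factor alone; the product \<open>G\<close> is
    unchanged.\<close>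
  have H_odd: "H (2 * i + 1) = H (2 * i)" if i: "i < Suc N" for i
  proof -
    let ?s = "transpose (2 * i) (2 * i + 1)"
    have "G (p \<circ> ?s) = G p" if p: "p permutes {..<M}" for p
    proof -
      have "(\<Prod>l<Suc N. A ((p \<circ> ?s) (2 * l)) ((p \<circ> ?s) (2 * l + 1))) =
        (\<Prod>l<Suc N. (if l = i then - 1 else 1) * A (p (2 * l)) (p (2 * l + 1)))"
      proof (rule prod.cong[OF refl])
        fix l
        show "A ((p \<circ> ?s) (2 * l)) ((p \<circ> ?s) (2 * l + 1)) =
          (if l = i then - 1 else 1) * A (p (2 * l)) (p (2 * l + 1))"
        proof (cases "l = i")
          case True
          then show ?thesis
            using skew[of "p (2 * i + 1)" "p (2 * i)"] by simp
        next
          case False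
          then have "?s (2 * l) = 2 * l" "?s (2 * l + 1) = 2 * l + 1"
            by (auto intro!: transpose_apply_other)
          with False show ?thesis by simp
        qed
      qed
      also have "\<dots> = - (\<Prod>l<Suc N. A (p (2 * l)) (p (2 * l + 1)))"
        unfolding prod.distrib using i by simp
      finally show ?thesis
        unfolding G_def sgn[OF p] by simp
    qed
    moreover have "?s permutes {..<M}"
      using i by (intro tr) (auto simp: M_def)
    ultimately show ?thesis
      using H_eq[of ?s "2 * i + 1"] by simp
  qed
  have H_even: "H (2 * i) = H 0" if i: "i < Suc N" for i
  proof (cases "i = 0")
    case False
    \<comment> \<open>Exchanging pair 0 with pair \<open>i\<close> takes two transpositions, hence
      is even, and merely reorders the factors.\<close>
    let ?s = "transpose 0 (2 * i) \<circ> transpose 1 (2 * i + 1)"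
    have s_even: "?s (2 * l) = 2 * transpose 0 i l" for l
      using False by (auto simp: transpose_def)
    have s_odd: "?s (2 * l + 1) = 2 * transpose 0 i l + 1" for l
      using False by (auto simp: transpose_def)
    have s: "transpose 0 (2 * i) permutes {..<M}" "transpose 1 (2 * i + 1) permutes {..<M}"
      by (rule tr; use i in \<open>simp add: M_def\<close>)+
    have "G (p \<circ> ?s) = G p" if p: "p permutes {..<M}" for p
    proof -
      have "sign (p \<circ> ?s) = sign ((p \<circ> transpose 0 (2 * i)) \<circ> transpose 1 (2 * i + 1))"
        by (simp add: comp_assoc)
      also have "\<dots> = sign p"
        using False by (simp add: sgn[OF permutes_compose[OF s(1) p]] sgn[OF p])
      finally have 1: "sign (p \<circ> ?s) = sign p" .
      have "(\<Prod>l<Suc N. A ((p \<circ> ?s) (2 * l)) ((p \<circ> ?s) (2 * l + 1))) =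
        (\<Prod>l<Suc N. A (p (2 * transpose 0 i l)) (p (2 * transpose 0 i l + 1)))"
        by (simp only: o_apply[of p] s_even s_odd)
      also have "\<dots> = (\<Prod>l<Suc N. A (p (2 * l)) (p (2 * l + 1)))"
        by (rule prod.reindex_bij_witness[where i = "transpose 0 i" and j = "transpose 0 i"])
          (use i in \<open>auto simp: transpose_def\<close>)
      finally show ?thesis
        unfolding G_def 1 by simp
    qed
    moreover have "?s permutes {..<M}"
      using s by (intro permutes_compose) auto
    moreover have "?s (2 * i) = 0" "?s 0 = 2 * i"
      using False by (auto simp: transpose_def)
    ultimately show ?thesis
      using H_eq[of ?s "2 * i"] by simp
  qed simp
  have H_all: "H x = H 0" if "x < M" for x
  proof (cases "even x")
    case True
    then obtain i where "x = 2 * i" by blast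
    with that H_even[of i] show ?thesis by (simp add: M_def)
  next
    case False
    then obtain i where "x = 2 * i + 1" using oddE by blast
    with that H_even[of i] H_odd[of i] show ?thesis by (simp add: M_def)
  qed
  \<comment> \<open>Each \<open>p\<close> takes the value 0 at exactly one position, so the sum
    splits according to that position.\<close>
  have "(\<Sum>p | p permutes {..<M}. G p) =
    (\<Sum>p | p permutes {..<M}. \<Sum>x<M. if p x = 0 then G p else 0)"
  proof (rule sum.cong[OF refl])
    fix p assume "p \<in> {p. p permutes {..<M}}"
    then have p: "p permutes {..<M}" by simp
    have "(\<Sum>x<M. if p x = 0 then G p else 0) = (\<Sum>x<M. if x = inv p 0 then G p else 0)"
      using permutes_inverses[OF p] by (intro sum.cong refl) (metis (full_types))
    also have "\<dots> = G p"
      using permutes_in_image[OF permutes_inv[OF p], of 0] by (simp add: M_def)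
    finally show "G p = (\<Sum>x<M. if p x = 0 then G p else 0)" ..
  qed
  also have "\<dots> = (\<Sum>x<M. H x)"
    unfolding H_def by (rule sum.swap)
  also have "\<dots> = (\<Sum>x<M. H 0)"
    by (rule sum.cong[OF refl], rule H_all) simp
  also have "\<dots> = real M * H 0"
    by simp
  finally have total: "(\<Sum>p | p permutes {..<M}. G p) = real M * H 0" .

  define F where "F p = (\<Prod>i<Suc N. A (p (2 * i)) (p (2 * i + 1)))" for p
  have set0: "{..<M} = insert 0 {1..<M}" and set1: "{1..<M} = insert 1 {2..<M}"
    by (auto simp: M_def)
  have set2: "{2..<M} = (\<lambda>i. i + 2) ` {..<2 * N}"
    unfolding lessThan_atLeast0 image_add_atLeastLessThan' by (simp add: M_def numeral_2_eq_2)
  have "H 0 = (\<Sum>p | p permutes {..<M}. of_int (sign p) * (if p 0 = 0 then F p else 0))"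
    unfolding H_def G_def F_def by (rule sum.cong) auto
  \<comment> \<open>Here \<open>b\<close> is the image of 0, because \<open>q\<close> fixes 0; only
    \<open>b = 0\<close> survives.\<close>
  also have "\<dots> = (\<Sum>b\<in>{..<M}. (if 0 = b then 1 else - 1) *
       (\<Sum>q | q permutes {1..<M}. of_int (sign q) *
         (if (transpose 0 b \<circ> q) 0 = 0 then F (transpose 0 b \<circ> q) else 0)))"
    unfolding set0 by (rule sum_signed_permutations_insert) auto
  also have "\<dots> = (\<Sum>b\<in>{..<M}. if b = 0 then (\<Sum>q | q permutes {1..<M}. of_int (sign q) * F q) else 0)"
  proof (rule sum.cong[OF refl])
    fix b
    have "(if (transpose 0 b \<circ> q) 0 = 0 then F (transpose 0 b \<circ> q) else 0) =
      (if b = 0 then F q else 0)" if "q \<in> {q. q permutes {1..<M}}" for q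
    proof -
      have "q 0 = 0"
        using that by (intro permutes_not_in[of q "{1..<M}"]) auto
      then show ?thesis by simp
    qed
    then have "(\<Sum>q | q permutes {1..<M}. of_int (sign q) *
         (if (transpose 0 b \<circ> q) 0 = 0 then F (transpose 0 b \<circ> q) else 0)) =
      (\<Sum>q | q permutes {1..<M}. of_int (sign q) * (if b = 0 then F q else 0))"
      by (intro sum.cong refl arg_cong2[where f = "(*)"])
    then show "(if 0 = b then 1 else - 1) * (\<Sum>q | q permutes {1..<M}. of_int (sign q) *
         (if (transpose 0 b \<circ> q) 0 = 0 then F (transpose 0 b \<circ> q) else 0)) =
      (if b = 0 then (\<Sum>q | q permutes {1..<M}. of_int (sign q) * F q) else 0)"
      by simp
  qed
  also have "\<dots> = (\<Sum>q | q permutes {1..<M}. of_int (sign q) * F q)"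
  proof -
    have "0 < M" by (simp add: M_def)
    then show ?thesis by simp
  qed
  \<comment> \<open>The same decomposition at 1: now \<open>b\<close> is the image of 1, and the
    first factor of the product becomes \<open>A 0 b\<close>.\<close>
  also have "\<dots> = (\<Sum>b\<in>{1..<M}. (if 1 = b then 1 else - 1) *
       (\<Sum>q | q permutes {2..<M}. of_int (sign q) * F (transpose 1 b \<circ> q)))"
    unfolding set1 by (rule sum_signed_permutations_insert) auto
  also have "\<dots> = (\<Sum>b\<in>{1..<M}. (if b = 1 then 1 else - 1) * (A 0 b *
       (\<Sum>q | q permutes {..<2 * N}. of_int (sign q) *
         (\<Prod>i<N. A (transpose 1 b (q (2 * i) + 2)) (transpose 1 b (q (2 * i + 1) + 2))))))"
  proof (rule sum.cong[OF refl])
    fix b assume b: "b \<in> {1..<M}"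
    have "(\<Sum>q | q permutes {2..<M}. of_int (sign q) * F (transpose 1 b \<circ> q)) =
      (\<Sum>q | q permutes {..<2 * N}. of_int (sign q) *
         F (transpose 1 b \<circ> map_permutation {..<2 * N} (\<lambda>i. i + 2) q))"
      unfolding set2 by (rule sum_signed_permutations_image) (auto simp: inj_on_def)
    also have "\<dots> = (\<Sum>q | q permutes {..<2 * N}. of_int (sign q) * (A 0 b *
         (\<Prod>i<N. A (transpose 1 b (q (2 * i) + 2)) (transpose 1 b (q (2 * i + 1) + 2)))))"
    proof (rule sum.cong[OF refl])
      fix q assume "q \<in> {q. q permutes {..<2 * N}}"
      then have q: "q permutes {..<2 * N}" by simp
      let ?q = "map_permutation {..<2 * N} (\<lambda>i. i + 2) q"
      have "?q permutes {2..<M}"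
        unfolding set2 by (rule map_permutation_permutes[OF _ q]) (simp add: bij_betw_def inj_on_def)
      then have q01: "?q 0 = 0" "?q 1 = 1"
        by (auto intro: permutes_not_in)
      have q2: "?q (i + 2) = q i + 2" if "i < 2 * N" for i
        using that map_permutation_apply[of "\<lambda>i. i + 2" "{..<2 * N}" i q]
        by (simp add: inj_on_def)
      have "F (transpose 1 b \<circ> ?q) = A (transpose 1 b (?q 0)) (transpose 1 b (?q 1)) *
         (\<Prod>i<N. A (transpose 1 b (?q (2 * i + 2))) (transpose 1 b (?q (2 * i + 1 + 2))))"
        unfolding F_def prod.lessThan_Suc_shift by simp
      also have "(\<Prod>i<N. A (transpose 1 b (?q (2 * i + 2))) (transpose 1 b (?q (2 * i + 1 + 2)))) =
         (\<Prod>i<N. A (transpose 1 b (q (2 * i) + 2)) (transpose 1 b (q (2 * i + 1) + 2)))"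
        by (rule prod.cong[OF refl], subst (1 2) q2) auto
      also have "transpose 1 b (?q 0) = 0"
        using b unfolding q01 by (intro transpose_apply_other) auto
      also have "transpose 1 b (?q 1) = b"
        unfolding q01 by simp
      finally have "F (transpose 1 b \<circ> ?q) = A 0 b *
         (\<Prod>i<N. A (transpose 1 b (q (2 * i) + 2)) (transpose 1 b (q (2 * i + 1) + 2)))" .
      then show "of_int (sign q) * F (transpose 1 b \<circ> ?q) = of_int (sign q) * (A 0 b *
         (\<Prod>i<N. A (transpose 1 b (q (2 * i) + 2)) (transpose 1 b (q (2 * i + 1) + 2))))"
        by simp
    qed
    also have "\<dots> = A 0 b * (\<Sum>q | q permutes {..<2 * N}. of_int (sign q) *
         (\<Prod>i<N. A (transpose 1 b (q (2 * i) + 2)) (transpose 1 b (q (2 * i + 1) + 2))))"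
      by (simp only: sum_distrib_left mult.left_commute)
    finally show "(if 1 = b then 1 else - 1) *
       (\<Sum>q | q permutes {2..<M}. of_int (sign q) * F (transpose 1 b \<circ> q)) =
      (if b = 1 then 1 else - 1) * (A 0 b * (\<Sum>q | q permutes {..<2 * N}. of_int (sign q) *
         (\<Prod>i<N. A (transpose 1 b (q (2 * i) + 2)) (transpose 1 b (q (2 * i + 1) + 2)))))"
      by (simp only: eq_commute[of 1 b])
  qed
  also have "\<dots> = (\<Sum>b\<in>{1..<M}. (if b = 1 then 1 else - 1) * A 0 b *
    pfaffian N (\<lambda>r s. A (transpose 1 b (r + 2)) (transpose 1 b (s + 2)))) * (2 ^ N * fact N)"
    unfolding sum_distrib_right pfaffian_def by (intro sum.cong refl) simp
  finally have "H 0 = (\<Sum>b\<in>{1..<M}. (if b = 1 then 1 else - 1) * A 0 b *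
    pfaffian N (\<lambda>r s. A (transpose 1 b (r + 2)) (transpose 1 b (s + 2)))) * (2 ^ N * fact N)" .
  moreover have "pfaffian (Suc N) A = real M * H 0 / (2 ^ Suc N * fact (Suc N))"
    using total unfolding pfaffian_def G_def by (simp only: M_def)
  \<comment> \<open>The number \<open>M\<close> of equal contributions is the quotient of the two
    normalising constants.\<close>
  moreover have "real M * (x * (2 ^ N * fact N)) / (2 ^ Suc N * fact (Suc N)) = x" for x :: real
    by (simp add: M_def divide_simps)
  moreover have "M = 2 * N + 2"
    by (simp add: M_def)
  ultimately show ?thesis
    by simp
qed

subsection \<open>Pfaffians of lists of symbols\<close>

text \<open>Like \<open>Pf\<close>, but for any type of symbols and any entries, so that auxiliary
  symbols can be adjoined. Only lists of even length are meaningful.\<close>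

definition list_pf :: "('a \<Rightarrow> 'a \<Rightarrow> real) \<Rightarrow> 'a list \<Rightarrow> real" where
  "list_pf f xs = pfaffian (length xs div 2) (\<lambda>i j. f (xs ! i) (xs ! j))"

lemma list_pf_Nil [simp]: "list_pf f [] = 1"
  by (simp add: list_pf_def pfaffian_def sign_id)

lemma list_pf_map_cong:
  assumes "\<And>i j. f (h i) (h j) = g (h' i) (h' j)"
  shows "list_pf f (map h xs) = list_pf g (map h' xs)"
  unfolding list_pf_def length_map by (rule pfaffian_cong) (simp add: assms)

lemma list_pf_Cons_map_cong:
  assumes "\<And>i j. f (h i) (h j) = g (h' i) (h' j)"
    and "\<And>i. f x (h i) = g x' (h' i)" "\<And>i. f (h i) x = g (h' i) x'" "f x x = g x' x'"
  shows "list_pf f (x # map h xs) = list_pf g (x' # map h' xs)"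
  unfolding list_pf_def length_map list.size
  by (rule pfaffian_cong) (auto simp: assms nth_Cons')

definition omit :: "nat \<Rightarrow> 'a list \<Rightarrow> 'a list" where
  "omit j xs = take j xs @ drop (Suc j) xs"

lemma omit_Cons_0 [simp]: "omit 0 (x # xs) = xs"
  by (simp add: omit_def)

lemma omit_Cons_Suc [simp]: "omit (Suc j) (x # xs) = x # omit j xs"
  by (simp add: omit_def)

lemma length_omit [simp]: "j < length xs \<Longrightarrow> length (omit j xs) = length xs - 1"
  by (auto simp: omit_def)

section \<open>Alternation, row expansion and linearity of Pfaffians of a skew form\<close>

locale skew_form =
  fixes f :: "'a \<Rightarrow> 'a \<Rightarrow> real"
  assumes skew: "f x y = - f y x"
begin

lemma self_zero [simp]: "f x x = 0"
  using skew[of x x] by simp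

lemma list_pf_swap:
  assumes "even (length xs + length ys)"
  shows "list_pf f (xs @ x # y # ys) = - list_pf f (xs @ y # x # ys)"
proof -
  let ?n = "length xs" and ?as = "xs @ y # x # ys"
  let ?q = "transpose ?n (Suc ?n)"
  let ?N = "length ?as div 2"
  have N: "2 * ?N = length ?as"
    using assms by auto
  have q: "?q permutes {..<2 * ?N}"
    unfolding N by (rule permutes_swap_id) auto
  have "list_pf f (xs @ x # y # ys) = pfaffian ?N (\<lambda>i j. f (?as ! ?q i) (?as ! ?q j))"
    unfolding list_pf_def
    by (auto intro!: pfaffian_cong arg_cong2[where f = f] simp: nth_append nth_Cons' transpose_def)
  also have "\<dots> = - list_pf f ?as"
    unfolding list_pf_def
    by (subst pfaffian_permute[OF q]) (simp add: sign_swap_id)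
  finally show ?thesis .
qed

lemma list_pf_move:
  assumes "odd (length ws + length xs + length ys)"
  shows "list_pf f (ws @ xs @ y # ys) = (- 1) ^ length xs * list_pf f (ws @ y # xs @ ys)"
  using assms
proof (induction xs arbitrary: ws)
  case (Cons x xs)
  have "list_pf f (ws @ (x # xs) @ y # ys) = list_pf f ((ws @ [x]) @ xs @ y # ys)"
    by simp
  also have "\<dots> = (- 1) ^ length xs * list_pf f (ws @ x # y # (xs @ ys))"
    using Cons.prems by (subst Cons.IH) auto
  also have "list_pf f (ws @ x # y # (xs @ ys)) = - list_pf f (ws @ y # x # (xs @ ys))"
    using Cons.prems by (intro list_pf_swap) auto
  finally show ?case by simp
qed simp

text \<open>Two equal symbols can be brought next to each other up to sign, and swapping equal
  neighbours negates the Pfaffian.\<close>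

lemma list_pf_not_distinct:
  assumes "\<not> distinct xs" "even (length xs)"
  shows "list_pf f xs = 0"
proof -
  obtain ws y us zs where xs: "xs = ws @ [y] @ us @ [y] @ zs"
    using not_distinct_decomp[OF assms(1)] by blast
  have "list_pf f xs = list_pf f ((ws @ [y]) @ us @ y # zs)"
    by (simp add: xs)
  also have "\<dots> = (- 1) ^ length us * list_pf f (ws @ y # y # (us @ zs))"
    using assms(2) by (subst list_pf_move) (auto simp: xs)
  also have "list_pf f (ws @ y # y # (us @ zs)) = 0"
    using list_pf_swap[of ws "us @ zs" y y] assms(2) by (simp add: xs)
  finally show ?thesis by simp
qed

text \<open>In the minor given by \<open>pfaffian_expand\<close> the first symbol of
  \<open>as\<close> stands in the place of the omitted one. For \<open>j > 0\<close>, moving it back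
  to the front passes \<open>j - 1\<close> symbols, and the resulting sign together with the factor
  -1 is \<open>(- 1) ^ j\<close>.\<close>

lemma list_pf_Cons:
  assumes "odd (length as)"
  shows "list_pf f (a # as) = (\<Sum>j<length as. (- 1) ^ j * f a (as ! j) * list_pf f (omit j as))"
proof -
  define N where "N = length as div 2"
  have len: "length as = 2 * N + 1"
    using assms unfolding N_def by presburger
  let ?A = "\<lambda>i j. f ((a # as) ! i) ((a # as) ! j)"
  let ?B = "\<lambda>b r s. ?A (transpose 1 b (r + 2)) (transpose 1 b (s + 2))"
  have "list_pf f (a # as) = pfaffian (Suc N) ?A"
    by (simp add: list_pf_def len)
  also have "\<dots> = (\<Sum>b\<in>{1..<2 * N + 2}. (if b = 1 then 1 else - 1) * ?A 0 b * pfaffian N (?B b))"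
    by (rule pfaffian_expand) (rule skew)
  also have "\<dots> = (\<Sum>j<length as. (- 1) ^ j * f a (as ! j) * list_pf f (omit j as))"
  proof (rule sum.reindex_bij_witness[where i = Suc and j = "\<lambda>b. b - 1"])
    fix b assume b: "b \<in> {1..<2 * N + 2}"
    then obtain j where j: "b = Suc j" "j < length as"
      by (cases b) (auto simp: len)
    have "(if b = 1 then 1 else - 1) * pfaffian N (?B b) = (- 1) ^ j * list_pf f (omit j as)"
    proof (cases j)
      case 0
      obtain x xs where as: "as = x # xs"
        using len by (cases as) auto
      have "pfaffian N (?B b) = list_pf f (omit j as)"
        using len unfolding list_pf_def 0 j as
        by (auto intro!: pfaffian_cong)
      then show ?thesis by (simp add: j 0)
    next
      case (Suc i)
      obtain x xs y ys where as: "as = x # xs @ y # ys" and xs: "length xs = i"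
      proof -
        from j Suc have "as = take j as @ as ! j # drop (Suc j) as" "take j as \<noteq> []"
          by (auto simp: id_take_nth_drop)
        moreover have "length (take j as) = Suc i"
          using j Suc by simp
        ultimately show thesis
          using that by (cases "take j as") auto
      qed
      have "pfaffian N (?B b) = list_pf f (xs @ x # ys)"
        using len xs unfolding list_pf_def j Suc as
        by (auto intro!: pfaffian_cong arg_cong2[where f = f] simp: nth_append nth_Cons' transpose_def)
      also have "\<dots> = (- 1) ^ i * list_pf f (x # xs @ ys)"
      proof -
        have "odd (length xs + length ys)"
          using len by (simp add: as) presburger
        then show ?thesis
          using list_pf_move[of "[]" xs ys x] xs by simp
      qed
      also have "x # xs @ ys = omit j as"
        by (simp add: omit_def as Suc xs)
      finally show ?thesis by (simp add: j Suc)
    qed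
    then show "(- 1) ^ (b - 1) * f a (as ! (b - 1)) * list_pf f (omit (b - 1) as) =
      (if b = 1 then 1 else - 1) * ?A 0 b * pfaffian N (?B b)"
      by (simp add: j mult.assoc mult.left_commute)
  qed (auto simp: len)
  finally show ?thesis .
qed

lemma list_pf_pair [simp]: "list_pf f [x, y] = f x y"
  by (simp add: list_pf_Cons)

text \<open>With \<open>z\<close> moved to the front, the expansion is linear in the row of
  \<open>z\<close>, and only its pairings with the other symbols of the list enter.\<close>

lemma list_pf_add:
  assumes "odd (length xs + length ys)"
    and "\<And>w. w \<in> set xs \<union> set ys \<Longrightarrow> f z w = f x w + f y w"
  shows "list_pf f (xs @ z # ys) = list_pf f (xs @ x # ys) + list_pf f (xs @ y # ys)"
proof -
  have "f z ((xs @ ys) ! j) = f x ((xs @ ys) ! j) + f y ((xs @ ys) ! j)"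
    if "j < length (xs @ ys)" for j
    using nth_mem[OF that] by (intro assms(2)) simp
  then have "list_pf f (z # xs @ ys) = list_pf f (x # xs @ ys) + list_pf f (y # xs @ ys)"
    using assms(1) by (simp add: list_pf_Cons flip: sum.distrib) (simp add: algebra_simps)
  then show ?thesis
    using list_pf_move[of "[]" xs ys] assms(1) by (simp add: algebra_simps)
qed

section \<open>Quadratic Pluecker relations between Pfaffians\<close>

text \<open>Expanding the first Pfaffian on the left or the second on the right gives the same double sum.\<close>

lemma list_pf_exchange:
  assumes "odd (length as)" "odd (length bs)"
  shows "(\<Sum>i<length bs. (- 1) ^ i * list_pf f (bs ! i # as) * list_pf f (omit i bs)) =
    - (\<Sum>j<length as. (- 1) ^ j * list_pf f (omit j as) * list_pf f (as ! j # bs))"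
proof -
  have "(\<Sum>i<length bs. (- 1) ^ i * list_pf f (bs ! i # as) * list_pf f (omit i bs)) =
    (\<Sum>i<length bs. \<Sum>j<length as. (- 1) ^ i * (- 1) ^ j * f (bs ! i) (as ! j) *
      list_pf f (omit j as) * list_pf f (omit i bs))"
    using assms by (simp add: list_pf_Cons sum_distrib_left sum_distrib_right mult.assoc)
  also have "\<dots> = (\<Sum>j<length as. \<Sum>i<length bs. (- 1) ^ i * (- 1) ^ j * f (bs ! i) (as ! j) *
      list_pf f (omit j as) * list_pf f (omit i bs))"
    by (rule sum.swap)
  also have "\<dots> = (\<Sum>j<length as. - ((- 1) ^ j * list_pf f (omit j as) * list_pf f (as ! j # bs)))"
  proof (rule sum.cong[OF refl])
    fix j
    have "- ((- 1) ^ j * list_pf f (omit j as) * list_pf f (as ! j # bs)) =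
      (\<Sum>i<length bs. - ((- 1) ^ j * list_pf f (omit j as) *
         ((- 1) ^ i * f (as ! j) (bs ! i) * list_pf f (omit i bs))))"
      using assms by (simp add: list_pf_Cons sum_distrib_left sum_negf)
    also have "\<dots> = (\<Sum>i<length bs. (- 1) ^ i * (- 1) ^ j * f (bs ! i) (as ! j) *
      list_pf f (omit j as) * list_pf f (omit i bs))"
      by (intro sum.cong refl) (subst skew, simp add: algebra_simps)
    finally show "(\<Sum>i<length bs. (- 1) ^ i * (- 1) ^ j * f (bs ! i) (as ! j) *
      list_pf f (omit j as) * list_pf f (omit i bs)) =
      - ((- 1) ^ j * list_pf f (omit j as) * list_pf f (as ! j # bs))" ..
  qed
  finally show ?thesis by (simp add: sum_negf)
qed

text \<open>In \<open>list_pf_exchange\<close> for \<open>w # L\<close> and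
  \<open>x # y # z # L\<close>, every term that moves a symbol of \<open>L\<close> repeats it and
  vanishes; three terms remain on one side and one on the other.\<close>

lemma list_pf_pluecker_even:
  assumes "even (length L)"
  shows "list_pf f L * list_pf f (w # x # y # z # L) =
    list_pf f (w # x # L) * list_pf f (y # z # L) - list_pf f (w # y # L) * list_pf f (x # z # L)
    + list_pf f (w # z # L) * list_pf f (x # y # L)"
proof -
  have "list_pf f (L ! i # w # L) = 0" "list_pf f (L ! i # x # y # z # L) = 0"
    if "i < length L" for i
    using that assms by (auto intro!: list_pf_not_distinct)
  moreover have "list_pf f (v # w # L) = - list_pf f (w # v # L)" for v
    using list_pf_swap[of "[]" L v w] assms by simp
  ultimately show ?thesis
    using list_pf_exchange[of "w # L" "x # y # z # L"] assms
    by (simp add: sum.lessThan_Suc_shift del: sum.lessThan_Suc)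
qed

text \<open>In \<open>list_pf_exchange\<close> for \<open>L\<close> and
  \<open>w # x # y # z # L\<close>, one side vanishes altogether because of repeated symbols; on the
  other side the four terms moving \<open>w\<close>, \<open>x\<close>, \<open>y\<close>,
  \<open>z\<close> remain.\<close>

lemma list_pf_pluecker_odd:
  assumes "odd (length L)"
  shows "list_pf f (w # L) * list_pf f (x # y # z # L) - list_pf f (x # L) * list_pf f (w # y # z # L)
    + list_pf f (y # L) * list_pf f (w # x # z # L) - list_pf f (z # L) * list_pf f (w # x # y # L) = 0"
proof -
  have "list_pf f (L ! i # L) = 0" "list_pf f (L ! i # w # x # y # z # L) = 0"
    if "i < length L" for i
    using that assms by (auto intro!: list_pf_not_distinct)
  then show ?thesis
    using list_pf_exchange[of L "w # x # y # z # L"] assms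
    by (simp add: sum.lessThan_Suc_shift del: sum.lessThan_Suc)
qed

text \<open>The alternating values make \<open>c\<close> orthogonal to every \<open>J i\<close>. In
  the presence of \<open>c\<close> and \<open>I m\<close> the symbols \<open>I i\<close> may be
  turned into \<open>J i\<close> by row operations, after which the row of \<open>c\<close> has the
  single nonzero entry at \<open>I m\<close>.\<close>

lemma list_pf_shift:
  assumes c: "\<And>x. x \<in> set X \<Longrightarrow> f c x = 0" "\<And>i. f c (I i) = (- 1) ^ i"
    and J: "\<And>i w. f (J i) w = f (I i) w + f (I (Suc i)) w"
    and even: "even (length X + m)"
  shows "list_pf f (X @ map J [0..<m]) = list_pf f (X @ c # map I [0..<Suc m])"
proof -
  \<comment> \<open>Turning \<open>I k\<close> into \<open>J k\<close> adds a Pfaffian in which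
    \<open>I (Suc k)\<close> occurs twice. Proceeding from left to right keeps
    \<open>I (Suc k)\<close> in the list.\<close>
  have step: "list_pf f (X @ c # map J [0..<k] @ map I [k..<Suc m]) =
    list_pf f (X @ c # map I [0..<Suc m])" if "k \<le> m" for k
    using that
  proof (induction k)
    case (Suc k)
    let ?P = "X @ c # map J [0..<k]" and ?S = "map I [Suc k..<Suc m]"
    have S: "I (Suc k) \<in> set ?S"
      using Suc.prems by (auto simp del: upt_Suc)
    have len: "odd (length ?P + length ?S)"
      using Suc.prems even by auto
    have "list_pf f (X @ c # map J [0..<Suc k] @ ?S) = list_pf f (?P @ J k # ?S)"
      by simp
    also have "\<dots> = list_pf f (?P @ I k # ?S) + list_pf f (?P @ I (Suc k) # ?S)"
      using J by (intro list_pf_add[OF len])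
    also have "list_pf f (?P @ I (Suc k) # ?S) = 0"
      using S len by (intro list_pf_not_distinct) auto
    also have "?P @ I k # ?S = X @ c # map J [0..<k] @ map I [k..<Suc m]"
      using Suc.prems by (simp add: upt_conv_Cons del: upt_Suc)
    finally show ?case
      using Suc by simp
  qed simp
  let ?L = "X @ map J [0..<m]"
  have "f c (J i) = 0" for i
    using J[of i c] c(2) by (subst skew) (simp add: skew[of "I _" c])
  then have zero: "f c w = 0" if "w \<in> set ?L" for w
    using that c(1) by auto
  have "list_pf f (X @ c # map I [0..<Suc m]) = list_pf f (X @ c # map J [0..<m] @ [I m])"
    using step[of m] by simp
  also have "\<dots> = (- 1) ^ length X * list_pf f (c # ?L @ [I m])"
    using list_pf_move[of "[]" X "map J [0..<m] @ [I m]" c] even by simp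
  also have "list_pf f (c # ?L @ [I m]) = (- 1) ^ length ?L * f c (I m) * list_pf f ?L"
  proof -
    have "f c ((?L @ [I m]) ! j) = 0" if "j < length ?L" for j
      using nth_mem[OF that] that zero by (simp only: nth_append if_True)
    moreover have "omit (length ?L) (?L @ [I m]) = ?L" "(?L @ [I m]) ! length ?L = I m"
      "length (?L @ [I m]) = Suc (length ?L)"
      by (simp_all only: omit_def nth_append_length) simp_all
    ultimately show ?thesis
      using even by (subst list_pf_Cons) (simp_all only: sum.lessThan_Suc, simp_all)
  qed
  \<comment> \<open>The signs from moving \<open>c\<close> to the front, from the column of
    \<open>I m\<close> and from the entry \<open>f c (I m)\<close> cancel.\<close>
  also have "(- 1) ^ length X * ((- 1) ^ length ?L * f c (I m) * list_pf f ?L) = list_pf f ?L"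
    by (simp add: c(2) power_add flip: power_mult_distrib mult.assoc)
  finally show ?thesis ..
qed

end

subsection \<open>Rank two updates and the bilinear identity\<close>

locale rank_two_update = skew_form f for f :: "'a \<Rightarrow> 'a \<Rightarrow> real" +
  fixes a b :: 'a
  assumes ab: "f a b = 0"
begin

text \<open>Since \<open>f a b = 0\<close>, the increment is the Pfaffian of \<open>a\<close>,
  \<open>b\<close>, \<open>x\<close>, \<open>y\<close> with respect to \<open>f\<close>.\<close>

definition update :: "'a \<Rightarrow> 'a \<Rightarrow> real" where
  "update x y = f x y + f b x * f a y - f a x * f b y"

sublocale update: skew_form update
  by unfold_locales (subst update_def, subst update_def, subst skew, simp)

text \<open>Induction on the length, expanding along the first symbol \<open>x\<close>: the
  increments in the row of \<open>x\<close> supply exactly the terms that complete the expansion of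
  the Pfaffian of \<open>x # a # b # K\<close>; contributions of second order in the increment
  vanish.\<close>

lemma list_pf_update:
  assumes "even (length L)"
  shows "list_pf update L = list_pf f L + list_pf f (a # b # L)"
  using assms
proof (induction L rule: length_induct)
  case (1 L)
  show ?case
  proof (cases L)
    case Nil
    then show ?thesis by (simp add: ab)
  next
    case (Cons x K)
    have K: "odd (length K)"
      using 1 Cons by simp
    have ba: "f b a = 0"
      using skew[of b a] ab by simp
    let ?s = "\<lambda>h G. \<Sum>j<length K. (- 1) ^ j * h (K ! j) * G (omit j K)"
    have IH: "list_pf update (omit j K) = list_pf f (omit j K) + list_pf f (a # b # omit j K)"
      if "j < length K" for j
      using 1 that K by (auto simp: Cons)
    have e: "list_pf f (y # K) = ?s (f y) (list_pf f)" for y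
      using K by (simp add: list_pf_Cons)
    have e3: "list_pf f (y # a # b # K) = f y a * list_pf f (b # K) - f y b * list_pf f (a # K)
      + ?s (f y) (\<lambda>M. list_pf f (a # b # M))" for y
      using K by (subst list_pf_Cons) (simp_all add: sum.lessThan_Suc_shift del: sum.lessThan_Suc)
    \<comment> \<open>These sums are the expansions of Pfaffians in which \<open>a\<close> or
      \<open>b\<close> occurs twice; the two leading terms drop out because \<open>a\<close> and
      \<open>b\<close> pair to zero.\<close>
    have a: "?s (f a) (\<lambda>M. list_pf f (a # b # M)) = 0" and b: "?s (f b) (\<lambda>M. list_pf f (a # b # M)) = 0"
      using e3[of a] e3[of b] K list_pf_not_distinct[of "a # a # b # K"]
        list_pf_not_distinct[of "b # a # b # K"] by (simp_all add: ab ba)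
    have x: "?s (f x) (\<lambda>M. list_pf f (a # b # M)) =
      list_pf f (a # b # x # K) + f a x * list_pf f (b # K) - f b x * list_pf f (a # K)"
      using e3[of x] list_pf_move[of "[]" "[a, b]" K x] K skew[of x a] skew[of x b] by simp
    have "list_pf update (x # K) = ?s (update x) (list_pf update)"
      using K by (simp add: update.list_pf_Cons)
    also have "\<dots> = (\<Sum>j<length K. (- 1) ^ j * update x (K ! j) *
       (list_pf f (omit j K) + list_pf f (a # b # omit j K)))"
      by (intro sum.cong refl) (simp add: IH)
    also have "\<dots> = ?s (f x) (list_pf f) + f b x * ?s (f a) (list_pf f) - f a x * ?s (f b) (list_pf f)
       + ?s (f x) (\<lambda>M. list_pf f (a # b # M)) + f b x * ?s (f a) (\<lambda>M. list_pf f (a # b # M))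
       - f a x * ?s (f b) (\<lambda>M. list_pf f (a # b # M))"
      unfolding sum_distrib_left sum.distrib[symmetric] sum_subtractf[symmetric]
      by (intro sum.cong refl) (simp add: update_def algebra_simps)
    also have "\<dots> = list_pf f (x # K) + list_pf f (a # b # x # K)"
      unfolding a b x e by simp
    finally show ?thesis by (simp add: Cons)
  qed
qed

text \<open>The correction term repeats \<open>a\<close> or \<open>b\<close>.\<close>

lemma list_pf_update_member:
  assumes "even (length L)" "a \<in> set L \<or> b \<in> set L"
  shows "list_pf update L = list_pf f L"
  using assms list_pf_not_distinct[of "a # b # L"] by (subst list_pf_update) auto

lemma update_pairing: "update a x = f a x" "update b x = f b x"
  using ab skew[of b a] by (simp_all add: update_def)

text \<open>The correction term itself contains \<open>a\<close> and \<open>b\<close>, so it has the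
  same value for \<open>f\<close> and for \<open>update\<close>.\<close>

lemma list_pf_downdate:
  assumes "even (length L)"
  shows "list_pf f L = list_pf update L - list_pf update (a # b # L)"
  using assms list_pf_update[of L] list_pf_update_member[of "a # b # L"] by simp

end

text \<open>One step of the lattice: \<open>a\<close> and \<open>b\<close> stand for d0 at k and k +
  1. On the symbols \<open>I\<close> the forms \<open>f\<close> and \<open>update\<close> give the
  entries at k and k + 1, on the symbols \<open>J\<close> those at k + 1 and k + 2; level k + 1 thus
  appears twice.\<close>

locale discrete_chain = rank_two_update f a b for f :: "'a \<Rightarrow> 'a \<Rightarrow> real" and a b +
  fixes c :: 'a and I J :: "nat \<Rightarrow> 'a"
  assumes ac: "f a c = 0" and bc: "f b c = 0"
    and cI: "f c (I i) = (- 1) ^ i"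
    and J: "f (J i) w = f (I i) w + f (I (Suc i)) w"
begin

section \<open>Removal of the summed indices \<open>J\<close> in favour of \<open>c\<close>\<close>

lemma ca: "f c a = 0" and cb: "f c b = 0"
  using ac bc skew[of c] by simp_all

lemma list_pf_J:
  "even m \<Longrightarrow> list_pf f (map J [0..<m]) = list_pf f (c # map I [0..<Suc m])"
  "odd m \<Longrightarrow> list_pf f (a # map J [0..<m]) = list_pf f (a # c # map I [0..<Suc m])"
  using list_pf_shift[of "[]" c I J m, OF _ cI J] list_pf_shift[of "[a]" c I J m, OF _ cI J]
  by (simp_all add: ca)

text \<open>As \<open>c\<close> is orthogonal to \<open>a\<close> and \<open>b\<close>, its pairings
  survive the update; the additivity of \<open>J\<close> survives because the increment is
  bilinear.\<close>

lemma list_pf_update_J: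
  "even m \<Longrightarrow> list_pf update (map J [0..<m]) = list_pf update (c # map I [0..<Suc m])"
  "odd m \<Longrightarrow> list_pf update (b # map J [0..<m]) = list_pf update (b # c # map I [0..<Suc m])"
proof -
  have c: "update c w = f c w" for w
    by (simp add: update_def ac bc)
  have cI': "update c (I i) = (- 1) ^ i" for i
    by (simp add: c cI)
  have "f v (J i) = f v (I i) + f v (I (Suc i))" for v i
    using J[of i v] skew[of v] by simp
  then have J': "update (J i) w = update (I i) w + update (I (Suc i)) w" for i w
    by (simp add: update_def J algebra_simps)
  show "even m \<Longrightarrow> list_pf update (map J [0..<m]) = list_pf update (c # map I [0..<Suc m])"
    "odd m \<Longrightarrow> list_pf update (b # map J [0..<m]) = list_pf update (b # c # map I [0..<Suc m])"
    using update.list_pf_shift[of "[]" c I J m, OF _ cI' J'] update.list_pf_shift[of "[b]" c I J m, OF _ cI' J']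
    by (simp_all add: c cb)
qed

lemma list_pf_last_first:
  assumes "odd (length X + n)"
  shows "list_pf update (X @ map I [0..<Suc n]) = (- 1) ^ n * list_pf update (X @ I n # map I [0..<n])"
  using update.list_pf_move[of X "map I [0..<n]" "[]" "I n"] assms by simp

text \<open>The assumption \<open>eq\<close> equates the two representations of the tau function at
  n + 1, k + 1. With \<open>L\<close> the indices 0 to n and \<open>z\<close> the index n + 1, all
  factors become Pfaffians for \<open>update\<close>, and the claim is the even Pluecker relation
  for \<open>a\<close>, \<open>b\<close>, \<open>c\<close>, \<open>z\<close>.\<close>

lemma bilinear_odd:
  assumes "odd n"
    and eq: "list_pf f (map J [0..<Suc n]) = list_pf update (map I [0..<Suc n])"
  shows "list_pf update (map J [0..<Suc n]) * list_pf f (map I [0..<Suc n])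
      - (list_pf update (map I [0..<Suc n]))\<^sup>2 =
    list_pf f (a # map I [0..<Suc (Suc n)]) * list_pf update (b # map J [0..<n])
      - list_pf update (b # map I [0..<Suc (Suc n)]) * list_pf f (a # map J [0..<n])"
proof -
  define L where "L = map I [0..<Suc n]"
  define z where "z = I (Suc n)"
  have L: "even (length L)"
    using assms(1) by (simp add: L_def)
  \<comment> \<open>The last index passes \<open>n + 1\<close> symbols, an even number, so no sign
    arises.\<close>
  have last: "list_pf update (x # map I [0..<Suc (Suc n)]) = list_pf update (x # z # L)" for x
    using list_pf_last_first[of "[x]" "Suc n"] assms(1) unfolding L_def z_def by simp
  have aL: "list_pf f (a # map I [0..<Suc (Suc n)]) = list_pf update (a # z # L)"
    using list_pf_update_member[of "a # map I [0..<Suc (Suc n)]"] assms(1) last[of a] by simp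
  have gJ: "list_pf update (map J [0..<Suc n]) = list_pf update (c # z # L)"
    using list_pf_update_J(1)[of "Suc n"] assms(1) last[of c] by simp
  have bJ: "list_pf update (b # map J [0..<n]) = list_pf update (b # c # L)"
    using list_pf_update_J(2)[of n] assms(1) by (simp add: L_def)
  have aJ: "list_pf f (a # map J [0..<n]) = list_pf update (a # c # L)"
    using list_pf_J(2)[of n] list_pf_update_member[of "a # c # L"] assms(1) L by (simp add: L_def)
  have fL: "list_pf f L = list_pf update L - list_pf update (a # b # L)"
    by (rule list_pf_downdate[OF L])
  have "list_pf update L = list_pf f (c # map I [0..<Suc (Suc n)])"
    using eq list_pf_J(1)[of "Suc n"] assms(1) by (simp add: L_def)
  also have "\<dots> = list_pf update (c # map I [0..<Suc (Suc n)]) - list_pf update (a # b # c # map I [0..<Suc (Suc n)])"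
    using assms(1) by (intro list_pf_downdate) simp
  also have "\<dots> = list_pf update (c # z # L) - list_pf update (a # b # c # z # L)"
    using last[of c] list_pf_last_first[of "[a, b, c]" "Suc n"] assms(1)
    unfolding L_def z_def by simp
  finally have gL: "list_pf update L = list_pf update (c # z # L) - list_pf update (a # b # c # z # L)" .
  \<comment> \<open>Only one factor of the square is rewritten by the other representation. The
    first product then cancels against a term of the left-hand side, and the second is the one
    containing all four extra symbols.\<close>
  have "(list_pf update L)\<^sup>2 = list_pf update L * list_pf update (c # z # L) - list_pf update L * list_pf update (a # b # c # z # L)"
    unfolding power2_eq_square by (subst (2) gL) (simp add: right_diff_distrib)
  then show ?thesis
    using update.list_pf_pluecker_even[OF L, of a b c z]
    unfolding gJ aL bJ aJ last unfolding L_def[symmetric] fL by (simp add: algebra_simps)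
qed

text \<open>The number of indices in \<open>L\<close> is now odd, so the symbol \<open>a\<close> or
  \<open>b\<close> completes the Pfaffians of tau at n + 1, and the odd Pluecker relation takes
  over. Moving \<open>z\<close> now costs a sign.\<close>

lemma bilinear_even:
  assumes "even n"
    and eq: "list_pf f (a # map J [0..<Suc n]) = list_pf update (b # map I [0..<Suc n])"
  shows "list_pf update (b # map J [0..<Suc n]) * list_pf f (a # map I [0..<Suc n])
      - (list_pf update (b # map I [0..<Suc n]))\<^sup>2 =
    list_pf f (map I [0..<Suc (Suc n)]) * list_pf update (map J [0..<n])
      - list_pf update (map I [0..<Suc (Suc n)]) * list_pf f (map J [0..<n])"
proof -
  define L where "L = map I [0..<Suc n]"
  define z where "z = I (Suc n)"
  have L: "odd (length L)"
    using assms(1) by (simp add: L_def)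
  have last: "list_pf update (X @ map I [0..<Suc (Suc n)]) = - list_pf update (X @ z # L)"
    if "even (length X)" for X
    using list_pf_last_first[of X "Suc n"] assms(1) that unfolding L_def z_def by simp
  have last0: "list_pf update (map I [0..<Suc (Suc n)]) = - list_pf update (z # L)"
    using last[of "[]"] by simp
  have last2: "list_pf update (x # y # map I [0..<Suc (Suc n)]) = - list_pf update (x # y # z # L)" for x y
    using last[of "[x, y]"] by simp
  have fL: "list_pf f (map I [0..<Suc (Suc n)]) = - list_pf update (z # L) + list_pf update (a # b # z # L)"
    using list_pf_downdate[of "map I [0..<Suc (Suc n)]"] last0 last2[of a b] assms(1) by simp
  have aL: "list_pf f (a # L) = list_pf update (a # L)"
    using list_pf_update_member[of "a # L"] L by simp
  have gJ: "list_pf update (map J [0..<n]) = list_pf update (c # L)"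
    using list_pf_update_J(1)[of n] assms(1) by (simp add: L_def)
  have fJ: "list_pf f (map J [0..<n]) = list_pf update (c # L) - list_pf update (a # b # c # L)"
    using list_pf_J(1)[of n] list_pf_downdate[of "c # L"] assms(1) L by (simp add: L_def)
  have bJ: "list_pf update (b # map J [0..<Suc n]) = - list_pf update (b # c # z # L)"
    using list_pf_update_J(2)[of "Suc n"] assms(1) last2[of b c] by simp
  have "list_pf update (b # L) = list_pf f (a # c # map I [0..<Suc (Suc n)])"
    using eq list_pf_J(2)[of "Suc n"] assms(1) by (simp add: L_def)
  also have "\<dots> = list_pf update (a # c # map I [0..<Suc (Suc n)])"
    using list_pf_update_member[of "a # c # map I [0..<Suc (Suc n)]"] assms(1) by simp
  finally have gb: "list_pf update (b # L) = - list_pf update (a # c # z # L)"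
    unfolding last2 .
  \<comment> \<open>Again one factor only is replaced, which gives the mixed product occurring in
    the Pluecker relation.\<close>
  have "(list_pf update (b # L))\<^sup>2 = - (list_pf update (b # L) * list_pf update (a # c # z # L))"
    unfolding power2_eq_square by (subst (2) gb) simp
  then show ?thesis
    using update.list_pf_pluecker_odd[OF L, of a b c z]
    unfolding gJ fJ bJ fL last0 unfolding L_def[symmetric] aL by (simp add: algebra_simps)
qed

end

subsection \<open>The B-Toda lattice\<close>

text \<open>
  \<open>Old\<close> and \<open>New\<close> are \<open>d\<^sub>0\<close> at the superscripts \<open>k\<close> and \<open>k + 1\<close>, both paired by the entries at \<open>k\<close>;
  \<open>Sum i\<close> is the formal sum of \<open>Vec i\<close> and \<open>Vec (i + 1)\<close>, and \<open>Alt\<close> is the symbol that pairs to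
  zero with all of these sums.  The entries are antisymmetrised from one half of the table, hence
  the factors \<open>1 / 2\<close>.
\<close>

datatype chain_symb = Old | New | Alt | Vec nat | Sum nat

text \<open>The row of \<open>New\<close> on \<open>Sum\<close> is beta at k + 2. The final default
  also covers \<open>Alt\<close> against \<open>Sum\<close>, where neighbouring signs
  cancel.\<close>

fun half_entry :: "(nat \<Rightarrow> nat \<Rightarrow> real) \<Rightarrow> (nat \<Rightarrow> real) \<Rightarrow> chain_symb \<Rightarrow> chain_symb \<Rightarrow> real" where
  "half_entry \<mu> \<beta> Old (Vec i) = \<beta> i"
| "half_entry \<mu> \<beta> Old (Sum i) = \<beta> i + \<beta> (Suc i)"
| "half_entry \<mu> \<beta> New (Vec i) = \<beta> i + \<beta> (Suc i)"
| "half_entry \<mu> \<beta> New (Sum i) = \<beta> i + 2 * \<beta> (Suc i) + \<beta> (Suc (Suc i))"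
| "half_entry \<mu> \<beta> Alt (Vec i) = (- 1) ^ i"
| "half_entry \<mu> \<beta> (Vec i) (Vec j) = \<mu> i j / 2"
| "half_entry \<mu> \<beta> (Vec i) (Sum j) = \<mu> i j + \<mu> i (Suc j)"
| "half_entry \<mu> \<beta> (Sum i) (Sum j) =
    (\<mu> i j + \<mu> (Suc i) j + \<mu> i (Suc j) + \<mu> (Suc i) (Suc j)) / 2"
| "half_entry \<mu> \<beta> _ _ = 0"

definition chain_entry :: "(nat \<Rightarrow> nat \<Rightarrow> real) \<Rightarrow> (nat \<Rightarrow> real) \<Rightarrow> chain_symb \<Rightarrow> chain_symb \<Rightarrow> real" where
  "chain_entry \<mu> \<beta> x y = half_entry \<mu> \<beta> x y - half_entry \<mu> \<beta> y x"

lemma discrete_chain_chain_entry: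
  assumes skew: "\<And>i j. \<mu> i j = - \<mu> j i"
  shows "discrete_chain (chain_entry \<mu> \<beta>) Old New Alt Vec Sum"
proof
  fix i w
  show "chain_entry \<mu> \<beta> (Sum i) w = chain_entry \<mu> \<beta> (Vec i) w + chain_entry \<mu> \<beta> (Vec (Suc i)) w"
  proof (cases w)
    case (Vec j)
    then show ?thesis
      using skew[of j i] skew[of j "Suc i"] by (simp add: chain_entry_def)
  next
    case (Sum j)
    then show ?thesis
      using skew[of j i] skew[of j "Suc i"] skew[of "Suc j" i] skew[of "Suc j" "Suc i"]
      by (simp add: chain_entry_def field_simps)
  qed (simp_all add: chain_entry_def)
qed (simp_all add: chain_entry_def)

theorem theorem3p39:
  fixes \<mu> :: "nat \<Rightarrow> nat \<Rightarrow> nat \<Rightarrow> real" and \<beta> :: "nat \<Rightarrow> nat \<Rightarrow> real"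
    and \<tau> v u :: "nat \<Rightarrow> nat \<Rightarrow> real"
  assumes mu_skew: "\<And>k i j. \<mu> k i j = - \<mu> k j i"
    and mu_step: "\<And>k i j. \<mu> (k + 1) i j = \<mu> k i j + Pf (\<mu> k) (\<beta> k) [D0, D1, Idx i, Idx j]"
    and mu_shift: "\<And>k i j. \<mu> k i j + Pf (\<mu> k) (\<beta> k) [D0, D1, Idx i, Idx j]
        = \<mu> k i j + \<mu> k (i + 1) j + \<mu> k i (j + 1) + \<mu> k (i + 1) (j + 1)"
    and beta_step: "\<And>k i. \<beta> (k + 1) i = \<beta> k (i + 1) + \<beta> k i"
    and tau_even: "\<And>k n. \<tau> k (2 * n) = Pf (\<mu> k) (\<beta> k) (map Idx [0..<2 * n])"
    and tau_odd: "\<And>k n. \<tau> k (2 * n + 1) = Pf (\<mu> k) (\<beta> k) (D0 # map Idx [0..<2 * n + 1])"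
    and tau_nonzero: "\<And>k n. \<tau> k n \<noteq> 0"
    and v_def: "\<And>k n. v k n = \<tau> k (n + 1) / \<tau> k n"
    and u_def: "\<And>k n. u k n = \<tau> (k + 1) n / \<tau> k n"
  shows "\<forall>n k.
      v (k + 1) n * u k n = v k n * u k (n + 1) \<and>
      u (k + 1) (n + 1) / u k (n + 1) =
        1 + (v k (n + 1) * u (k + 1) n) / (u k (n + 1) * v (k + 1) n)
          - v (k + 1) (n + 1) / v (k + 1) n"
proof -
  \<comment> \<open>The step in k is used in both of its forms: as a rank two term it describes
    \<open>update\<close>, as a sum over neighbours it describes the entries between the symbols
    \<open>Sum\<close>.\<close>
  have mu_product: "\<mu> (k + 1) i j = \<mu> k i j + (\<beta> k (i + 1) * \<beta> k j - \<beta> k i * \<beta> k (j + 1))" for k i j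
    unfolding mu_step Pf_D0_D1[OF mu_skew] ..
  have mu_sum: "\<mu> (k + 1) i j = \<mu> k i j + \<mu> k (i + 1) j + \<mu> k i (j + 1) + \<mu> k (i + 1) (j + 1)" for k i j
    unfolding mu_step mu_shift ..
  \<comment> \<open>Any skew form and any symbols that reproduce the entries at k compute the same
    tau functions; this yields several representations of one value.\<close>
  have tau: "(even n \<longrightarrow> list_pf F (map h [0..<n]) = \<tau> k n) \<and>
      (odd n \<longrightarrow> list_pf F (d # map h [0..<n]) = \<tau> k n)"
    if "skew_form F" "\<And>i j. F (h i) (h j) = \<mu> k i j" "\<And>i. F d (h i) = \<beta> k i"
    for F :: "chain_symb \<Rightarrow> chain_symb \<Rightarrow> real" and h d k n
  proof -
    interpret F: skew_form F by fact
    have Pf: "Pf (\<mu> k) (\<beta> k) = list_pf (Pf_entry (\<mu> k) (\<beta> k))"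
      by (simp add: fun_eq_iff Pf_def list_pf_def)
    have "list_pf F (map h [0..<n]) = list_pf (Pf_entry (\<mu> k) (\<beta> k)) (map Idx [0..<n])"
      by (rule list_pf_map_cong) (simp add: that)
    moreover have "F (h i) d = - \<beta> k i" for i
      using F.skew[of "h i" d] that(3) by simp
    then have "list_pf F (d # map h [0..<n]) = list_pf (Pf_entry (\<mu> k) (\<beta> k)) (D0 # map Idx [0..<n])"
      by (intro list_pf_Cons_map_cong) (simp_all add: that)
    ultimately show ?thesis
      using tau_even[of k "n div 2"] tau_odd[of k "n div 2"] unfolding Pf
      by (metis dvd_mult_div_cancel odd_two_times_div_two_succ)
  qed
  have bilinear: "\<tau> (k + 2) (n + 1) * \<tau> k (n + 1) - (\<tau> (k + 1) (n + 1))\<^sup>2 =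
    \<tau> k (n + 2) * \<tau> (k + 2) n - \<tau> (k + 1) (n + 2) * \<tau> (k + 1) n" for k n
  proof -
    let ?f = "chain_entry (\<mu> k) (\<beta> k)"
    interpret discrete_chain ?f Old New Alt Vec Sum
      by (rule discrete_chain_chain_entry) (rule mu_skew)
    have "\<mu> k i j / 2 - \<mu> k j i / 2 = \<mu> k i j" for i j
      using mu_skew[of k j i] by simp
    then have f_Vec: "?f (Vec i) (Vec j) = \<mu> k i j" for i j
      by (simp add: chain_entry_def)
    have f_Sum: "?f (Sum i) (Sum j) = \<mu> (k + 1) i j" for i j
      unfolding mu_sum J using J[of j "Vec i"] J[of j "Vec (Suc i)"]
        skew[of "Vec i" "Sum j"] skew[of "Vec (Suc i)" "Sum j"] mu_skew[of k j] mu_skew[of k "Suc j"]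
      by (simp add: f_Vec)
    \<comment> \<open>As beta at k + 1 is the sum of the rows of d0 and d1, pairing d0 with the new
      d0 gives the same rank two term as pairing it with d1.\<close>
    have upd_Vec: "update (Vec i) (Vec j) = \<mu> (k + 1) i j" for i j
      unfolding update_def f_Vec mu_product by (simp add: chain_entry_def algebra_simps)
    have upd_Sum: "update (Sum i) (Sum j) = \<mu> (k + 2) i j" for i j
    proof -
      have "\<mu> (k + 2) i j = \<mu> (k + 1) i j + (\<beta> (k + 1) (i + 1) * \<beta> (k + 1) j - \<beta> (k + 1) i * \<beta> (k + 1) (j + 1))"
        using mu_product[of "k + 1" i j] by simp
      then show ?thesis
        unfolding update_def f_Sum beta_step by (simp add: chain_entry_def algebra_simps)
    qed
    have beta2: "\<beta> (k + 2) i = \<beta> k i + 2 * \<beta> k (Suc i) + \<beta> k (Suc (Suc i))" for i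
      using beta_step[of "k + 1" i] by (simp add: beta_step[simplified])
    have T0: "even n \<Longrightarrow> list_pf ?f (map Vec [0..<n]) = \<tau> k n"
      "odd n \<Longrightarrow> list_pf ?f (Old # map Vec [0..<n]) = \<tau> k n" for n
      using tau[OF skew_form_axioms, of Vec k Old n] by (simp_all add: f_Vec) (simp_all add: chain_entry_def)
    have T1: "even n \<Longrightarrow> list_pf ?f (map Sum [0..<n]) = \<tau> (k + 1) n"
      "odd n \<Longrightarrow> list_pf ?f (Old # map Sum [0..<n]) = \<tau> (k + 1) n" for n
      using tau[OF skew_form_axioms, of Sum "k + 1" Old n] unfolding beta_step f_Sum
      by (simp_all add: chain_entry_def)
    \<comment> \<open>Together with \<open>T1\<close> this provides the assumption \<open>eq\<close>
      of the bilinear identities.\<close>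
    have T1': "even n \<Longrightarrow> list_pf update (map Vec [0..<n]) = \<tau> (k + 1) n"
      "odd n \<Longrightarrow> list_pf update (New # map Vec [0..<n]) = \<tau> (k + 1) n" for n
      using tau[OF update.skew_form_axioms, of Vec "k + 1" New n] unfolding beta_step upd_Vec update_pairing
      by (simp_all add: chain_entry_def)
    have T2: "even n \<Longrightarrow> list_pf update (map Sum [0..<n]) = \<tau> (k + 2) n"
      "odd n \<Longrightarrow> list_pf update (New # map Sum [0..<n]) = \<tau> (k + 2) n" for n
      using tau[OF update.skew_form_axioms, of Sum "k + 2" New n] unfolding beta2 upd_Sum update_pairing
      by (simp_all add: chain_entry_def)
    show ?thesis
    proof (cases "even n")
      case True
      then show ?thesis
        using bilinear_even[of n] by (simp add: T0 T1 T1' T2 del: upt_Suc)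
    next
      case False
      then show ?thesis
        using bilinear_odd[of n] by (simp add: T0 T1 T1' T2 del: upt_Suc)
    qed
  qed
  show ?thesis
  proof (intro allI conjI)
    fix n k
    show "v (k + 1) n * u k n = v k n * u k (n + 1)"
      by (simp add: v_def u_def tau_nonzero)
    let ?t = "\<tau> (k + 1) (n + 1)"
    have "u (k + 1) (n + 1) / u k (n + 1) = \<tau> (k + 2) (n + 1) * \<tau> k (n + 1) / ?t\<^sup>2"
      by (simp add: u_def power2_eq_square)
    also have "\<dots> = (?t\<^sup>2 + \<tau> k (n + 2) * \<tau> (k + 2) n - \<tau> (k + 1) (n + 2) * \<tau> (k + 1) n) / ?t\<^sup>2"
      using bilinear[of k n] by simp
    also have "\<dots> = 1 + \<tau> k (n + 2) * \<tau> (k + 2) n / ?t\<^sup>2 - \<tau> (k + 1) (n + 2) * \<tau> (k + 1) n / ?t\<^sup>2"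
      using tau_nonzero[of "k + 1" "n + 1"] by (simp add: diff_divide_distrib add_divide_distrib)
    also have "\<tau> k (n + 2) * \<tau> (k + 2) n / ?t\<^sup>2 = (v k (n + 1) * u (k + 1) n) / (u k (n + 1) * v (k + 1) n)"
      using tau_nonzero by (simp add: v_def u_def power2_eq_square field_simps)
    also have "\<tau> (k + 1) (n + 2) * \<tau> (k + 1) n / ?t\<^sup>2 = v (k + 1) (n + 1) / v (k + 1) n"
      by (simp add: v_def power2_eq_square)
    finally show "u (k + 1) (n + 1) / u k (n + 1) =
        1 + (v k (n + 1) * u (k + 1) n) / (u k (n + 1) * v (k + 1) n)
          - v (k + 1) (n + 1) / v (k + 1) n" .
  qed
qed

end
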